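(* Let $\gamma:\mathbb{S}^1\to\mathbb{R}^+$ be an anisotropic surface energy satisfying $\gamma(-\boldsymbol{n})=\gamma(\boldsymbol{n})$ for all $\boldsymbol{n}\in\mathbb{S}^1$ and whose one-homogeneous extension satisfies $\gamma(\boldsymbol{p})\in C^2(\mathbb{R}^2\setminus\{\boldsymbol{0}\})$. Let the stabilizing function $k:\mathbb{S}^1\to\mathbb{R}^+$ satisfy $k(\boldsymbol{n})\ge k_0(\boldsymbol{n})$ for all $\boldsymbol{n}\in\mathbb{S}^1$, where $k_0$ is the minimal stabilizing function of $\gamma$. Let $\tau>0$ and let $(\boldsymbol{X}^m,\mu^m)$, $m\ge 0$, be a solution of the scheme SP-PFEM (defined in the context) with time step $\tau$ and surface energy matrix $\boldsymbol{Z}_k$. Then the enclosed area is conserved and the energy is dissipated, i.e. $$A^m = A^0=\frac12\sum_{j=1}^N (x_j^0-x_{j-1}^0)(y_j^0+y_{j-1}^0),\qquad \forall m\ge 0,$$ $$W_c^{m+1}\le W_c^m\le\cdots\le W_c^0=\sum_{j=1}^N|\boldsymbol{h}_j^0|\,\gamma(\boldsymbol{n}_j^0),\qquad \forall m\ge 0 .$$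
   Context: Notation. $\mathbb{S}^1\subset\mathbb{R}^2$ is the unit circle, $\mathbb{R}^+=(0,\infty)$, and $^\perp$ denotes clockwise rotation by $\pi/2$, i.e. $(a,b)^\perp=(b,-a)$. A function $\gamma:\mathbb{S}^1\to\mathbb{R}^+$ is extended to $\mathbb{R}^2$ by $\gamma(\boldsymbol{p})=|\boldsymbol{p}|\gamma(\boldsymbol{p}/|\boldsymbol{p}|)$ for $\boldsymbol{p}\ne\boldsymbol{0}$ and $\gamma(\boldsymbol{0})=0$. The Cahn-Hoffman vector is $\boldsymbol{\xi}(\boldsymbol{n})=\nabla\gamma(\boldsymbol{p})|_{\boldsymbol{p}=\boldsymbol{n}}$. For $k:\mathbb{S}^1\to\mathbb{R}^+$ the surface energy matrix is $$\boldsymbol{Z}_k(\boldsymbol{n})=\gamma(\boldsymbol{n})I_2-\boldsymbol{n}\boldsymbol{\xi}(\boldsymbol{n})^T-\boldsymbol{\xi}(\boldsymbol{n})\boldsymbol{n}^T+k(\boldsymbol{n})\boldsymbol{n}\boldsymbol{n}^T .$$ Minimal stabilizing function. For $\hat{\boldsymbol{n}}\ne\pm\boldsymbol{n}$ in $\mathbb{S}^1$ let $$F(\boldsymbol{n},\hat{\boldsymbol{n}})=\frac{\gamma(\hat{\boldsymbol{n}})^2-\gamma(\boldsymbol{n})^2+2\gamma(\boldsymbol{n})(\boldsymbol{\xi}(\boldsymbol{n})\cdot\hat{\boldsymbol{n}}^\perp)(\boldsymbol{n}\cdot\hat{\boldsymbol{n}}^\perp)}{\gamma(\boldsymbol{n})(\boldsymbol{n}\cdot\hat{\boldsymbol{n}}^\perp)^2},$$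 extended to $\hat{\boldsymbol{n}}=\boldsymbol{n}$ by its limit as $\hat{\boldsymbol{n}}\to\boldsymbol{n}$ in $\mathbb{S}^1$ (which exists when $\gamma(\boldsymbol{p})\in C^2(\mathbb{R}^2\setminus\{\boldsymbol{0}\})$). Then $k_0(\boldsymbol{n})=\max\{F(\boldsymbol{n},\hat{\boldsymbol{n}}): \hat{\boldsymbol{n}}\in\mathbb{S}^1,\ \hat{\boldsymbol{n}}\cdot\boldsymbol{n}\ge0\}$. Discretization. $\mathbb{T}=\mathbb{R}/\mathbb{Z}=[0,1]$ (periodic), $N$ a positive integer, $h=1/N$, $\rho_j=jh$ ($0\le j\le N$), $I_j=[\rho_{j-1},\rho_j]$, and $\mathbb{K}^h=\{u\in C(\mathbb{T}): u|_{I_j}\text{ is a polynomial of degree}\le 1,\ j=1,\dots,N\}$. For $m\ge 0$, $\boldsymbol{X}^m=(x^m,y^m)^T\in[\mathbb{K}^h]^2$ parametrizes a closed polygonal curve $\Gamma^m=\boldsymbol{X}^m(\mathbb{T})$; $x_j^m=x^m(\rho_j)$, $y_j^m=y^m(\rho_j)$, $\boldsymbol{h}_j^m=\boldsymbol{X}^m(\rho_j)-\boldsymbol{X}^m(\rho_{j-1})$, assumed nonzero for all $j,m$; $\boldsymbol{n}^m|_{I_j}=\boldsymbol{n}_j^m=-(\boldsymbol{h}_j^m)^\perp/|\boldsymbol{h}_j^m|$. For $f\in\mathbb{K}^h$ or $[\mathbb{K}^h]^2$, $\partial_s f=|\partial_\rho\boldsymbol{X}^m|^{-1}\partial_\rho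 f$ (arclength derivative on $\Gamma^m$, piecewise constant). For piecewise continuous (scalar- or vector-valued) $u,v$, the mass lumped inner product is $$(u,v)^h_{\Gamma^m}=\frac12\sum_{j=1}^N|\boldsymbol{h}_j^m|\left[(u\cdot v)(\rho_j^-)+(u\cdot v)(\rho_{j-1}^+)\right],$$ with one-sided limits at the nodes. Put $\boldsymbol{n}^{m+\frac12}=-\frac12(\partial_s\boldsymbol{X}^m+\partial_s\boldsymbol{X}^{m+1})^\perp$. SP-PFEM with time step $\tau>0$: given $\boldsymbol{X}^0\in[\mathbb{K}^h]^2$, for each $m\ge0$, $\boldsymbol{X}^{m+1}\in[\mathbb{K}^h]^2$ and $\mu^{m+1}\in\mathbb{K}^h$ satisfy $$\Bigl(\tfrac{\boldsymbol{X}^{m+1}-\boldsymbol{X}^m}{\tau}\cdot\boldsymbol{n}^{m+\frac12},\varphi^h\Bigr)^h_{\Gamma^m}+\bigl(\partial_s\mu^{m+1},\partial_s\varphi^h\bigr)^h_{\Gamma^m}=0\quad\forall\varphi^h\in\mathbb{K}^h,$$ $$\bigl(\mu^{m+1},\boldsymbol{n}^{m+\frac12}\cdot\boldsymbol{\omega}^h\bigr)^h_{\Gamma^m}-\bigl(\boldsymbol{Z}_k(\boldsymbol{n}^m)\partial_s\boldsymbol{X}^{m+1},\partial_s\boldsymbol{\omega}^h\bigr)^h_{\Gamma^m}=0\quad\forall\boldsymbol{\omega}^h\in[\mathbb{K}^h]^2 .$$ Area and energy: $A^m=\frac12\sum_{j=1}^N(x_j^m-x_{j-1}^m)(y_j^m+y_{j-1}^m)$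 and $W_c^m=\sum_{j=1}^N|\boldsymbol{h}_j^m|\gamma(\boldsymbol{n}_j^m)$. *)

theory Defs
  imports "HOL-Analysis.Analysis" "HOL-Computational_Algebra.Polynomial"
begin

section \<open>Surface energies on the unit circle\<close>

text \<open>
  Functions on the unit circle are total functions on \<^typ>\<open>real ^ 2\<close> of which only the values on
  \<^term>\<open>sphere (0 :: real ^ 2) 1\<close> are used.
\<close>

text \<open>Clockwise rotation by a right angle.\<close>

definition perp :: "real ^ 2 \<Rightarrow> real ^ 2" where
  "perp p = vector [p $ 2, - p $ 1]"

definition hom_ext :: "(real ^ 2 \<Rightarrow> real) \<Rightarrow> real ^ 2 \<Rightarrow> real" where
  "hom_ext \<gamma> p = (if p = 0 then 0 else norm p * \<gamma> (p /\<^sub>R norm p))"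

text \<open>
  Twice Frechet differentiable with continuous second derivative, written through the gradient and
  the Hessian matrix; meant for open sets, since the derivatives are unrestricted.
\<close>

definition C2_on :: "(real ^ 2) set \<Rightarrow> (real ^ 2 \<Rightarrow> real) \<Rightarrow> bool" where
  "C2_on S f \<longleftrightarrow> (\<exists>(g :: real ^ 2 \<Rightarrow> real ^ 2) (H :: real ^ 2 \<Rightarrow> real ^ 2 ^ 2).
     (\<forall>p\<in>S. GDERIV f p :> g p) \<and>
     (\<forall>p\<in>S. (g has_derivative (\<lambda>v. H p *v v)) (at p)) \<and>
     continuous_on S H)"

definition gradient :: "(real ^ 2 \<Rightarrow> real) \<Rightarrow> real ^ 2 \<Rightarrow> real ^ 2" where
  "gradient f p = (THE D. GDERIV f p :> D)"

definition cahn_hoffman :: "(real ^ 2 \<Rightarrow> real) \<Rightarrow> real ^ 2 \<Rightarrow> real ^ 2" where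
  "cahn_hoffman \<gamma> n = gradient (hom_ext \<gamma>) n"

definition outer :: "real ^ 2 \<Rightarrow> real ^ 2 \<Rightarrow> real ^ 2 ^ 2" where
  "outer u v = (\<chi> i j. u $ i * v $ j)"

definition surface_energy_matrix ::
    "(real ^ 2 \<Rightarrow> real) \<Rightarrow> (real ^ 2 \<Rightarrow> real) \<Rightarrow> real ^ 2 \<Rightarrow> real ^ 2 ^ 2" where
  "surface_energy_matrix \<gamma> k n =
     \<gamma> n *\<^sub>R mat 1 - outer n (cahn_hoffman \<gamma> n) - outer (cahn_hoffman \<gamma> n) n + k n *\<^sub>R outer n n"

section \<open>The minimal stabilizing function\<close>

definition stab_quotient :: "(real ^ 2 \<Rightarrow> real) \<Rightarrow> real ^ 2 \<Rightarrow> real ^ 2 \<Rightarrow> real" where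
  "stab_quotient \<gamma> n n' =
     ((\<gamma> n')\<^sup>2 - (\<gamma> n)\<^sup>2 + 2 * \<gamma> n * (cahn_hoffman \<gamma> n \<bullet> perp n') * (n \<bullet> perp n'))
       / (\<gamma> n * (n \<bullet> perp n')\<^sup>2)"

text \<open>
  The limit at \<open>n' = n\<close> is taken along the unit circle. The value at \<open>n' = - n\<close> is a division by
  zero and is not used below.
\<close>

definition stab_F :: "(real ^ 2 \<Rightarrow> real) \<Rightarrow> real ^ 2 \<Rightarrow> real ^ 2 \<Rightarrow> real" where
  "stab_F \<gamma> n n' =
     (if n' = n then Lim (at n within sphere 0 1) (stab_quotient \<gamma> n) else stab_quotient \<gamma> n n')"

definition min_stab :: "(real ^ 2 \<Rightarrow> real) \<Rightarrow> real ^ 2 \<Rightarrow> real" where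
  "min_stab \<gamma> n =
     (GREATEST r. r \<in> {stab_F \<gamma> n n' | n'. n' \<in> sphere 0 1 \<and> n' \<bullet> n \<ge> 0})"

section \<open>Finite elements on the periodic unit interval\<close>

definition node :: "nat \<Rightarrow> nat \<Rightarrow> real" where
  "node N j = real j / real N"

text \<open>Functions on \<open>\<real>/\<int>\<close> are functions on the reals of period 1.\<close>

definition Kh :: "nat \<Rightarrow> (real \<Rightarrow> real) set" where
  "Kh N = {u. (\<forall>\<rho>. u (\<rho> + 1) = u \<rho>) \<and> continuous_on UNIV u \<and>
     (\<forall>j\<in>{1..N}. \<exists>p :: real poly. degree p \<le> 1 \<and> (\<forall>\<rho>\<in>{node N (j - 1)..node N j}. u \<rho> = poly p \<rho>))}"

definition Kh2 :: "nat \<Rightarrow> (real \<Rightarrow> real ^ 2) set" where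
  "Kh2 N = {u. \<forall>i. (\<lambda>\<rho>. u \<rho> $ i) \<in> Kh N}"

definition edge :: "nat \<Rightarrow> (real \<Rightarrow> real ^ 2) \<Rightarrow> nat \<Rightarrow> real ^ 2" where
  "edge N X j = X (node N j) - X (node N (j - 1))"

definition edge_normal :: "nat \<Rightarrow> (real \<Rightarrow> real ^ 2) \<Rightarrow> nat \<Rightarrow> real ^ 2" where
  "edge_normal N X j = - (perp (edge N X j) /\<^sub>R norm (edge N X j))"

text \<open>
  The piecewise constant normal as a function of the parameter: for \<open>\<rho>\<close> strictly between node
  \<open>j - 1\<close> and node \<open>j\<close> the index below is \<open>j\<close>. The values at the nodes themselves are immaterial,
  as only one-sided limits there are used.
\<close>

definition normal :: "nat \<Rightarrow> (real \<Rightarrow> real ^ 2) \<Rightarrow> real \<Rightarrow> real ^ 2" where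
  "normal N X \<rho> = edge_normal N X (nat \<lceil>\<rho> * real N\<rceil>)"

definition arc_deriv ::
    "(real \<Rightarrow> real ^ 2) \<Rightarrow> (real \<Rightarrow> 'a :: real_normed_vector) \<Rightarrow> real \<Rightarrow> 'a" where
  "arc_deriv X f \<rho> = vector_derivative f (at \<rho>) /\<^sub>R norm (vector_derivative X (at \<rho>))"

definition lumped ::
    "nat \<Rightarrow> (real \<Rightarrow> real ^ 2) \<Rightarrow> (real \<Rightarrow> 'a :: real_inner) \<Rightarrow> (real \<Rightarrow> 'a) \<Rightarrow> real" where
  "lumped N X u v = 1 / 2 * (\<Sum>j = 1..N. norm (edge N X j) *
     (Lim (at_left (node N j)) (\<lambda>\<rho>. u \<rho> \<bullet> v \<rho>) + Lim (at_right (node N (j - 1))) (\<lambda>\<rho>. u \<rho> \<bullet> v \<rho>)))"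

definition half_normal :: "(real \<Rightarrow> real ^ 2) \<Rightarrow> (real \<Rightarrow> real ^ 2) \<Rightarrow> real \<Rightarrow> real ^ 2" where
  "half_normal X X' \<rho> = - ((1 / 2) *\<^sub>R perp (arc_deriv X X \<rho> + arc_deriv X X' \<rho>))"

text \<open>In \<open>SP_PFEM\<close> the value \<open>\<mu> 0\<close> is irrelevant.\<close>

definition SP_PFEM ::
    "nat \<Rightarrow> real \<Rightarrow> (real ^ 2 \<Rightarrow> real) \<Rightarrow> (real ^ 2 \<Rightarrow> real) \<Rightarrow>
     (nat \<Rightarrow> real \<Rightarrow> real ^ 2) \<Rightarrow> (nat \<Rightarrow> real \<Rightarrow> real) \<Rightarrow> bool" where
  "SP_PFEM N \<tau> \<gamma> k X \<mu> \<longleftrightarrow>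
     X 0 \<in> Kh2 N \<and>
     (\<forall>m. X (Suc m) \<in> Kh2 N \<and> \<mu> (Suc m) \<in> Kh N \<and>
       (\<forall>\<phi>\<in>Kh N.
          lumped N (X m)
            (\<lambda>\<rho>. ((X (Suc m) \<rho> - X m \<rho>) /\<^sub>R \<tau>) \<bullet> half_normal (X m) (X (Suc m)) \<rho>) \<phi>
          + lumped N (X m) (arc_deriv (X m) (\<mu> (Suc m))) (arc_deriv (X m) \<phi>) = 0) \<and>
       (\<forall>\<omega>\<in>Kh2 N.
          lumped N (X m) (\<mu> (Suc m)) (\<lambda>\<rho>. half_normal (X m) (X (Suc m)) \<rho> \<bullet> \<omega> \<rho>)
          - lumped N (X m)
              (\<lambda>\<rho>. surface_energy_matrix \<gamma> k (normal N (X m) \<rho>) *v arc_deriv (X m) (X (Suc m)) \<rho>)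
              (arc_deriv (X m) \<omega>) = 0))"

definition area :: "nat \<Rightarrow> (real \<Rightarrow> real ^ 2) \<Rightarrow> real" where
  "area N X = 1 / 2 * (\<Sum>j = 1..N.
     (X (node N j) $ 1 - X (node N (j - 1)) $ 1) * (X (node N j) $ 2 + X (node N (j - 1)) $ 2))"

definition energy :: "nat \<Rightarrow> (real ^ 2 \<Rightarrow> real) \<Rightarrow> (real \<Rightarrow> real ^ 2) \<Rightarrow> real" where
  "energy N \<gamma> X = (\<Sum>j = 1..N. norm (edge N X j) * \<gamma> (edge_normal N X j))"

end

theory Submission
  imports Defs
begin

text \<open>
  Consider one step from the curve \<open>X\<close> to the curve \<open>Y\<close>. Testing the first equation with \<open>1\<close> makes
  the sum of the swept areas vanish, which is area conservation. Testing with \<open>\<mu>\<close> and with the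
  displacement \<open>Y - X\<close> gives \<open>(Z \<partial>\<^sub>s Y, \<partial>\<^sub>s (Y - X)) \<le> 0\<close>. On an edge of \<open>X\<close> with tangent \<open>t\<close> and normal
  \<open>n\<close>, let \<open>v = \<partial>\<^sub>s Y\<close> and let \<open>p\<close> be \<open>v\<close> rotated onto the normal direction. By homogeneity and
  evenness of \<open>\<gamma>\<close>, the bound \<open>k \<ge> k\<^sub>0\<close> says \<open>Z v \<bullet> v \<ge> \<gamma>(p)\<^sup>2 / \<gamma>(n)\<close>. In particular \<open>Z\<close> is positive
  semidefinite, so \<open>Z v \<bullet> (v - t) \<ge> (Z v \<bullet> v - Z t \<bullet> t) / 2\<close>; since \<open>Z t \<bullet> t = \<gamma>(n)\<close>, the inequality
  \<open>a\<^sup>2 / b + b \<ge> 2 a\<close> bounds this from below by \<open>\<gamma>(p) - \<gamma>(n)\<close>, the change of energy per unit length.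
  That \<open>k\<^sub>0\<close> is an attained maximum, not merely a formal one, follows from the continuity of the
  extended quotient on a compact half circle.
\<close>


section \<open>Rotation by a right angle in the plane\<close>

lemma perp_nth [simp]: "perp p $ 1 = p $ 2" "perp p $ 2 = - p $ 1"
  by (simp_all add: perp_def)

lemma inner_vec2: "(x :: real ^ 2) \<bullet> y = x $ 1 * y $ 1 + x $ 2 * y $ 2"
  by (simp add: inner_vec_def sum_2)

lemma norm_perp [simp]: "norm (perp p) = norm p"
  by (simp add: norm_eq_sqrt_inner inner_vec2)

lemma perp_perp [simp]: "perp (perp p) = - p"
  by (simp add: vec_eq_iff forall_2)

lemma perp_scaleR: "perp (c *\<^sub>R p) = c *\<^sub>R perp p"
  by (simp add: vec_eq_iff forall_2)

lemma perp_minus: "perp (- p) = - perp p"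
  by (simp add: vec_eq_iff forall_2)

lemma perp_eq_0_iff [simp]: "perp p = 0 \<longleftrightarrow> p = 0"
  by (metis norm_perp norm_eq_zero)

text \<open>\<open>n\<close> and \<open>perp n\<close> form an orthonormal basis. This supplies the
  normal and tangential coordinates used for points of the circle.\<close>

lemma unit_frame_expansion:
  assumes "norm n = 1"
  shows "(n \<bullet> p) *\<^sub>R n + (perp n \<bullet> p) *\<^sub>R perp n = p"
proof -
  have n: "n $ 1 * n $ 1 + n $ 2 * n $ 2 = 1"
    using assms by (simp add: norm_eq_1 inner_vec2)
  have "(n $ 1 * p $ 1 + n $ 2 * p $ 2) * n $ 1 + (n $ 2 * p $ 1 - n $ 1 * p $ 2) * n $ 2
      = p $ 1 * (n $ 1 * n $ 1 + n $ 2 * n $ 2)"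
    and "(n $ 1 * p $ 1 + n $ 2 * p $ 2) * n $ 2 - (n $ 2 * p $ 1 - n $ 1 * p $ 2) * n $ 1
      = p $ 2 * (n $ 1 * n $ 1 + n $ 2 * n $ 2)"
    by algebra+
  then show ?thesis
    using n by (simp add: vec_eq_iff forall_2 inner_vec2)
qed

lemma inner_perp_right: "x \<bullet> perp y = - (perp x \<bullet> y)"
  by (simp add: inner_vec2)

section \<open>The surface energy matrix\<close>

lemma outer_mult_vec: "outer u v *v w = (v \<bullet> w) *\<^sub>R u"
  by (simp add: vec_eq_iff forall_2 matrix_vector_mult_def outer_def inner_vec2 sum_2 algebra_simps)

lemma surface_energy_matrix_mult_vec:
  "surface_energy_matrix \<gamma> k n *v w = \<gamma> n *\<^sub>R w - (cahn_hoffman \<gamma> n \<bullet> w) *\<^sub>R n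
     - (n \<bullet> w) *\<^sub>R cahn_hoffman \<gamma> n + (k n * (n \<bullet> w)) *\<^sub>R n"
  by (simp add: surface_energy_matrix_def matrix_vector_mult_add_rdistrib
      matrix_vector_mult_diff_rdistrib outer_mult_vec flip: scaleR_matrix_vector_assoc)

text \<open>The two mixed outer products are transposes of each other. Symmetry merges the cross
  terms when the quadratic form is expanded at a difference of vectors.\<close>

lemma surface_energy_matrix_symmetric:
  "(surface_energy_matrix \<gamma> k n *v v) \<bullet> w = (surface_energy_matrix \<gamma> k n *v w) \<bullet> v"
  unfolding surface_energy_matrix_mult_vec
  by (simp add: inner_diff_left inner_add_left inner_commute[of v] algebra_simps)

lemma surface_energy_matrix_quadratic:
  "(surface_energy_matrix \<gamma> k n *v w) \<bullet> w =
     \<gamma> n * (w \<bullet> w) - 2 * (cahn_hoffman \<gamma> n \<bullet> w) * (n \<bullet> w) + k n * (n \<bullet> w)\<^sup>2"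
  unfolding surface_energy_matrix_mult_vec
  by (simp add: inner_diff_left inner_add_left power2_eq_square algebra_simps)

section \<open>The minimal stabilizing function is attained\<close>

lemma hom_ext_unit: "norm n = 1 \<Longrightarrow> hom_ext \<gamma> n = \<gamma> n"
  by (auto simp: hom_ext_def)

lemma hom_ext_scaleR: "c > 0 \<Longrightarrow> hom_ext \<gamma> (c *\<^sub>R p) = c * hom_ext \<gamma> p"
  by (auto simp: hom_ext_def field_simps)

text \<open>Derivatives are unique, so the definite description in \<open>gradient\<close> picks the
  derivative as soon as one exists.\<close>

lemma GDERIV_gradient:
  assumes "GDERIV f p :> D"
  shows "GDERIV f p :> gradient f p"
proof -
  have "E = D" if "GDERIV f p :> E" for E
  proof -
    have "(\<lambda>h. h \<bullet> E) = (\<lambda>h. h \<bullet> D)"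
      using that assms unfolding gderiv_def by (rule has_derivative_unique)
    then have "\<forall>h. h \<bullet> E = h \<bullet> D" by (rule fun_cong[THEN allI])
    then show ?thesis by (simp only: vector_eq_ldot)
  qed
  then show ?thesis unfolding gradient_def by (rule theI[of "\<lambda>E. GDERIV f p :> E", OF assms])
qed

text \<open>The witness \<open>g\<close> of \<open>C2_on\<close> coincides with
  \<open>gradient f\<close> on \<open>S\<close>; since \<open>S\<close> is open they agree near each
  of its points, so differentiability carries over.\<close>

lemma C2_on_gradient:
  assumes "C2_on S f" "open S"
  shows "\<forall>p\<in>S. GDERIV f p :> gradient f p"
    and "\<forall>p\<in>S. gradient f differentiable (at p)"
proof -
  obtain g H where g: "\<forall>p\<in>S. GDERIV f p :> g p"
    and H: "\<forall>p\<in>S. (g has_derivative (\<lambda>v. H p *v v)) (at p)"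
    using assms(1) unfolding C2_on_def by blast
  show *: "\<forall>p\<in>S. GDERIV f p :> gradient f p" using g GDERIV_gradient by blast
  have eq: "g p = gradient f p" if "p \<in> S" for p
  proof -
    have "(\<lambda>h. h \<bullet> g p) = (\<lambda>h. h \<bullet> gradient f p)"
      using that * g unfolding gderiv_def by (blast intro: has_derivative_unique)
    then have "\<forall>h. h \<bullet> g p = h \<bullet> gradient f p" by (rule fun_cong[THEN allI])
    then show ?thesis by (simp only: vector_eq_ldot)
  qed
  have "(gradient f has_derivative (\<lambda>v. H p *v v)) (at p)" if "p \<in> S" for p
    by (rule has_derivative_transform_within_open[OF H[rule_format, OF that] assms(2) that eq])
  then show "\<forall>p\<in>S. gradient f differentiable (at p)"
    by (auto intro: differentiableI)
qed

lemma GDERIV_line: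
  fixes f :: "real ^ 2 \<Rightarrow> real"
  assumes "GDERIV f (a + s *\<^sub>R t) :> D"
  shows "((\<lambda>s. f (a + s *\<^sub>R t)) has_real_derivative (D \<bullet> t)) (at s)"
proof -
  have "((\<lambda>s. a + s *\<^sub>R t) has_derivative (\<lambda>h. h *\<^sub>R t)) (at s)"
    by (auto intro!: derivative_eq_intros)
  from has_derivative_compose[OF this assms[unfolded gderiv_def]]
  have "((\<lambda>s. f (a + s *\<^sub>R t)) has_derivative (\<lambda>h. h *\<^sub>R t \<bullet> D)) (at s)" by simp
  then show ?thesis
    unfolding has_field_derivative_def by (simp add: inner_commute mult_commute_abs)
qed

text \<open>Euler's identity for one-homogeneous functions: on the ray through \<open>n\<close> the
  extension is \<open>s * \<gamma> n\<close>, and both expressions are differentiated at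
  \<open>s = 1\<close>.\<close>

lemma cahn_hoffman_inner_self:
  assumes "C2_on (UNIV - {0}) (hom_ext \<gamma>)" "norm n = 1"
  shows "cahn_hoffman \<gamma> n \<bullet> n = \<gamma> n"
proof -
  have "n \<noteq> 0" using assms(2) by auto
  then have "GDERIV (hom_ext \<gamma>) (0 + 1 *\<^sub>R n) :> cahn_hoffman \<gamma> n"
    unfolding cahn_hoffman_def using C2_on_gradient(1)[OF assms(1)] by (auto simp: open_delete)
  from GDERIV_line[OF this]
  have 1: "((\<lambda>s. hom_ext \<gamma> (s *\<^sub>R n)) has_real_derivative cahn_hoffman \<gamma> n \<bullet> n) (at 1)" by simp
  have "((\<lambda>s. s * \<gamma> n) has_real_derivative \<gamma> n) (at 1)"
    by (auto intro!: derivative_eq_intros)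
  then have "((\<lambda>s. hom_ext \<gamma> (s *\<^sub>R n)) has_real_derivative \<gamma> n) (at 1)"
    by (rule has_field_derivative_transform_within_open[where S = "{0<..}"])
       (auto simp: hom_ext_scaleR hom_ext_unit assms)
  with 1 show ?thesis by (rule DERIV_unique)
qed

text \<open>One use of l'Hopital's rule leaves half the difference quotient of
  \<open>\<phi>'\<close> at \<open>0\<close>, whose limit is \<open>c\<close> by definition.\<close>

lemma second_order_quotient_tendsto:
  fixes \<phi> \<phi>' :: "real \<Rightarrow> real"
  assumes "\<And>s. (\<phi> has_real_derivative \<phi>' s) (at s)" "(\<phi>' has_real_derivative c) (at 0)"
  shows "((\<lambda>s. (\<phi> s - \<phi> 0 - \<phi>' 0 * s) / s\<^sup>2) \<longlongrightarrow> c / 2) (at 0)"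
proof (rule lhopital[where f' = "\<lambda>s. \<phi>' s - \<phi>' 0" and g' = "\<lambda>s. 2 * s"])
  have "isCont \<phi> 0" using assms(1) DERIV_isCont by blast
  then have "\<phi> \<midarrow>0\<rightarrow> \<phi> 0" by (simp add: isCont_def)
  then have "((\<lambda>s. \<phi> s - \<phi> 0 - \<phi>' 0 * s) \<longlongrightarrow> \<phi> 0 - \<phi> 0 - \<phi>' 0 * 0) (at 0)"
    by (intro tendsto_intros)
  then show "((\<lambda>s. \<phi> s - \<phi> 0 - \<phi>' 0 * s) \<longlongrightarrow> 0) (at 0)" by simp
  have "((\<lambda>s. s\<^sup>2) \<longlongrightarrow> (0::real)\<^sup>2) (at 0)" by (intro tendsto_intros)
  then show "((\<lambda>s. s\<^sup>2) \<longlongrightarrow> (0::real)) (at 0)" by simp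
  show "\<forall>\<^sub>F s in at 0. (s::real)\<^sup>2 \<noteq> 0" by (auto simp: eventually_at_filter)
  show "\<forall>\<^sub>F s in at 0. 2 * (s::real) \<noteq> 0" by (auto simp: eventually_at_filter)
  show "\<forall>\<^sub>F s in at 0. ((\<lambda>s. \<phi> s - \<phi> 0 - \<phi>' 0 * s) has_real_derivative \<phi>' s - \<phi>' 0) (at s)"
    by (rule always_eventually) (auto intro!: derivative_eq_intros assms)
  show "\<forall>\<^sub>F s in at 0. ((\<lambda>s. s\<^sup>2) has_real_derivative 2 * s) (at (s::real))"
    by (rule always_eventually) (auto intro!: derivative_eq_intros)
  have "((\<lambda>s. (\<phi>' s - \<phi>' 0) / (s - 0)) \<longlongrightarrow> c) (at 0)"
    using assms(2) by (simp add: has_field_derivative_iff)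
  then have "((\<lambda>s. (\<phi>' s - \<phi>' 0) / (s - 0) / 2) \<longlongrightarrow> c / 2) (at 0)"
    by (intro tendsto_intros) auto
  then show "((\<lambda>s. (\<phi>' s - \<phi>' 0) / (2 * s)) \<longlongrightarrow> c / 2) (at 0)" by (simp add: mult.commute)
qed

text \<open>
  The line \<open>n + s t\<close> tangent to the circle at \<open>n\<close> meets the ray through \<open>n'\<close> at
  \<open>s = (t \<bullet> n') / (n \<bullet> n')\<close>; homogeneity then turns the quotient into a second order
  difference quotient of \<open>\<gamma>\<^sup>2\<close> along that line.
\<close>

lemma stab_quotient_tangent:
  fixes \<gamma> n n'
  defines "t \<equiv> perp n"
  defines "s \<equiv> (t \<bullet> n') / (n \<bullet> n')"
  assumes euler: "cahn_hoffman \<gamma> n \<bullet> n = \<gamma> n" and "norm n = 1" "norm n' = 1"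
    and pos: "n \<bullet> n' > 0" and "\<gamma> n \<noteq> 0" and "t \<bullet> n' \<noteq> 0"
  shows "stab_quotient \<gamma> n n' =
     ((hom_ext \<gamma> (n + s *\<^sub>R t))\<^sup>2 - (\<gamma> n)\<^sup>2 - 2 * \<gamma> n * (cahn_hoffman \<gamma> n \<bullet> t) * s) / s\<^sup>2 / \<gamma> n + \<gamma> n"
proof -
  define c a x where "c = n \<bullet> n'" and "a = t \<bullet> n'" and "x = cahn_hoffman \<gamma> n \<bullet> t"
  define G where "G = hom_ext \<gamma> (n + s *\<^sub>R t)"
  have n': "n' = c *\<^sub>R n + a *\<^sub>R t"
    using unit_frame_expansion[OF \<open>norm n = 1\<close>, of n'] by (simp add: c_def a_def t_def)
  have s: "s = a / c" by (simp add: s_def a_def c_def)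
  have c: "c > 0" and a: "a \<noteq> 0" using assms by (auto simp: c_def a_def)
  have "n' = c *\<^sub>R (n + s *\<^sub>R t)" using c s n' by (simp add: scaleR_add_right)
  then have g': "\<gamma> n' = c * G"
    using hom_ext_scaleR[OF c, of \<gamma> "n + s *\<^sub>R t"] hom_ext_unit[OF \<open>norm n' = 1\<close>, of \<gamma>]
    by (simp add: G_def)
  have p: "perp n' = c *\<^sub>R t - a *\<^sub>R n"
    unfolding n' by (simp add: t_def vec_eq_iff forall_2)
  have nn: "n \<bullet> n = 1" "n \<bullet> t = 0" using \<open>norm n = 1\<close> by (auto simp: t_def norm_eq_1 inner_vec2)
  have tt: "t \<bullet> t = 1" "t \<bullet> n = 0" using nn by (auto simp: t_def inner_vec2)
  have "n' \<bullet> n' = 1" using \<open>norm n' = 1\<close> by (simp add: norm_eq_1)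
  then have ca: "c\<^sup>2 + a\<^sup>2 = 1"
    unfolding n' using nn tt by (simp add: inner_add_left inner_add_right power2_eq_square)
  have 1: "n \<bullet> perp n' = - a" using nn by (simp add: p inner_diff_right)
  have 2: "cahn_hoffman \<gamma> n \<bullet> perp n' = c * x - a * \<gamma> n"
    using euler by (simp add: p inner_diff_right x_def)
  \<comment> \<open>The factor \<open>c\<^sup>2 + a\<^sup>2 = 1\<close> makes the numerator
    quadratic in \<open>(c, a)\<close>. After division by \<open>a\<^sup>2\<close> only
    \<open>s = a / c\<close> remains, and the pure \<open>a\<^sup>2\<close> terms become the summand
    \<open>\<gamma> n\<close>.\<close>
  have "stab_quotient \<gamma> n n' =
      (c\<^sup>2 * G\<^sup>2 - (\<gamma> n)\<^sup>2 * (c\<^sup>2 + a\<^sup>2) - 2 * \<gamma> n * (c * x - a * \<gamma> n) * a) / (\<gamma> n * a\<^sup>2)"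
    unfolding stab_quotient_def 1 2 g' ca by (simp add: power_mult_distrib)
  also have "\<dots> = (G\<^sup>2 - (\<gamma> n)\<^sup>2 - 2 * \<gamma> n * x * s) / s\<^sup>2 / \<gamma> n + \<gamma> n"
    using c a \<open>\<gamma> n \<noteq> 0\<close> unfolding s by (simp add: field_simps power2_eq_square)
  finally show ?thesis unfolding G_def x_def .
qed

text \<open>As \<open>p\<close> tends to \<open>n\<close> on the circle, its tangent parameter
  \<open>\<sigma> p\<close> tends to \<open>0\<close>, and the second order quotient of the squared
  energy on the tangent line converges. Hence the \<open>Lim\<close> in \<open>stab_F\<close> is a
  genuine limit.\<close>

lemma stab_quotient_convergent:
  assumes C2: "C2_on (UNIV - {0}) (hom_ext \<gamma>)" and n: "norm n = 1" and "\<gamma> n > 0"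
  shows "\<exists>l. (stab_quotient \<gamma> n \<longlongrightarrow> l) (at n within sphere 0 1)"
proof -
  define t where "t = perp n"
  define G where "G = hom_ext \<gamma>"
  define g where "g = gradient G"
  define \<phi> where "\<phi> s = (G (n + s *\<^sub>R t))\<^sup>2" for s
  define \<phi>' where "\<phi>' s = 2 * G (n + s *\<^sub>R t) * (g (n + s *\<^sub>R t) \<bullet> t)" for s
  have nn: "n \<bullet> n = 1" "n \<bullet> t = 0" using n by (auto simp: t_def norm_eq_1 inner_vec2)
  have n_nz: "n \<noteq> 0" using n by auto
  \<comment> \<open>The tangent line misses the origin, the one point where smoothness is not
    assumed.\<close>
  have nz: "n + s *\<^sub>R t \<noteq> 0" for s
  proof
    assume "n + s *\<^sub>R t = 0"
    then have "n \<bullet> (n + s *\<^sub>R t) = 0" by simp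
    then show False using nn by (simp add: inner_add_right)
  qed
  have op: "open (UNIV - {0 :: real ^ 2})" by (simp add: open_delete)
  note gr = C2_on_gradient[OF C2 op, folded G_def, folded g_def]
  have dG: "((\<lambda>s. G (n + s *\<^sub>R t)) has_real_derivative g (n + s *\<^sub>R t) \<bullet> t) (at s)" for s
    using nz gr(1) by (intro GDERIV_line) auto
  have d1: "(\<phi> has_real_derivative \<phi>' s) (at s)" for s
    unfolding \<phi>_def[abs_def] \<phi>'_def by (rule derivative_eq_intros dG | simp)+
  have "(\<lambda>s. g (n + s *\<^sub>R t)) differentiable (at (0::real))"
  proof -
    obtain g' where g': "(g has_derivative g') (at n)"
      using gr(2) n_nz unfolding differentiable_def by blast
    have "((\<lambda>s. n + s *\<^sub>R t) has_derivative (\<lambda>h. h *\<^sub>R t)) (at (0::real))"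
      by (auto intro!: derivative_eq_intros)
    from has_derivative_compose[OF this, of g g'] g' show ?thesis
      unfolding differentiable_def by auto
  qed
  then have "(\<lambda>s. g (n + s *\<^sub>R t) \<bullet> t) differentiable (at (0::real))"
    by (intro differentiable_inner) auto
  moreover have "(\<lambda>s. 2 * G (n + s *\<^sub>R t)) differentiable (at (0::real))"
    using dG by (intro differentiable_mult) (auto simp: real_differentiable_def)
  ultimately have "\<phi>' differentiable (at 0)"
    unfolding \<phi>'_def[abs_def] by (rule differentiable_mult[rotated])
  then obtain c where c: "(\<phi>' has_real_derivative c) (at 0)"
    by (auto simp: real_differentiable_def)
  define \<psi> where "\<psi> = (\<lambda>s. (\<phi> s - \<phi> 0 - \<phi>' 0 * s) / s\<^sup>2)"
  have lim: "(\<psi> \<longlongrightarrow> c / 2) (at 0)"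
    unfolding \<psi>_def using second_order_quotient_tendsto[OF d1 c] .
  define \<sigma> where "\<sigma> p = (t \<bullet> p) / (n \<bullet> p)" for p
  have ev_pos: "\<forall>\<^sub>F p in at n within sphere 0 1. n \<bullet> p > 0"
  proof -
    have "((\<lambda>p. n \<bullet> p) \<longlongrightarrow> n \<bullet> n) (at n within sphere 0 1)" by (intro tendsto_intros)
    then show ?thesis using nn by (auto dest: order_tendstoD(1)[where a = 0])
  qed
  have ev: "\<forall>\<^sub>F p in at n within sphere 0 1. n \<bullet> p > 0 \<and> t \<bullet> p \<noteq> 0 \<and> norm p = 1"
  proof -
    have "\<forall>\<^sub>F p in at n within sphere 0 1. p \<in> sphere 0 1 \<and> p \<noteq> n"
      by (auto simp: eventually_at_filter)
    with ev_pos show ?thesis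
    proof eventually_elim
      case (elim p)
      have "t \<bullet> p \<noteq> 0"
      proof
        assume "t \<bullet> p = 0"
        then have p: "p = (n \<bullet> p) *\<^sub>R n" using unit_frame_expansion[OF n, of p] by (simp add: t_def)
        then have "norm p = \<bar>n \<bullet> p\<bar> * norm n" by (metis norm_scaleR)
        then have "n \<bullet> p = 1" using elim n by simp
        then show False using p elim by simp
      qed
      then show ?case using elim by simp
    qed
  qed
  have "(\<sigma> \<longlongrightarrow> (t \<bullet> n) / (n \<bullet> n)) (at n within sphere 0 1)"
    unfolding \<sigma>_def[abs_def] using nn by (intro tendsto_intros) auto
  then have "(\<sigma> \<longlongrightarrow> 0) (at n within sphere 0 1)"
    using nn by (simp add: inner_commute)
  \<comment> \<open>The limit of \<open>\<psi>\<close> is taken in a punctured neighbourhood of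
    \<open>0\<close>, so \<open>\<sigma>\<close> must avoid \<open>0\<close>; it does near
    \<open>n\<close>, as only \<open>n\<close> and \<open>- n\<close> have no tangential
    part.\<close>
  moreover have "\<forall>\<^sub>F p in at n within sphere 0 1. \<sigma> p \<noteq> 0"
    using ev by eventually_elim (auto simp: \<sigma>_def)
  ultimately have "filterlim \<sigma> (at 0) (at n within sphere 0 1)"
    by (simp add: filterlim_at)
  then have "((\<lambda>p. \<psi> (\<sigma> p)) \<longlongrightarrow> c / 2) (at n within sphere 0 1)"
    using lim by (rule filterlim_compose[rotated])
  then have "((\<lambda>p. \<psi> (\<sigma> p) / \<gamma> n + \<gamma> n) \<longlongrightarrow> c / 2 / \<gamma> n + \<gamma> n) (at n within sphere 0 1)"
    using \<open>\<gamma> n > 0\<close> by (intro tendsto_intros) auto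
  moreover have "\<forall>\<^sub>F p in at n within sphere 0 1. \<psi> (\<sigma> p) / \<gamma> n + \<gamma> n = stab_quotient \<gamma> n p"
    using ev
  proof eventually_elim
    case (elim p)
    have "\<phi> 0 = (\<gamma> n)\<^sup>2" "\<phi>' 0 = 2 * \<gamma> n * (cahn_hoffman \<gamma> n \<bullet> t)"
      by (simp_all add: \<phi>_def \<phi>'_def g_def G_def cahn_hoffman_def hom_ext_unit[OF n])
    then show ?case
      using stab_quotient_tangent[OF cahn_hoffman_inner_self[OF C2 n] n, of p] elim \<open>\<gamma> n > 0\<close>
      by (simp add: \<psi>_def \<sigma>_def t_def \<phi>_def G_def)
  qed
  ultimately have "(stab_quotient \<gamma> n \<longlongrightarrow> c / 2 / \<gamma> n + \<gamma> n) (at n within sphere 0 1)"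
    by (rule Lim_transform_eventually)
  then show ?thesis ..
qed

text \<open>A unit vector without tangential component is a unit multiple of \<open>n\<close>. Thus
  the denominator of \<open>stab_quotient\<close> vanishes only at \<open>n\<close> and
  \<open>- n\<close>.\<close>

lemma unit_vector_eq_or_opposite:
  assumes "norm n = 1" "norm p = 1" "n \<bullet> perp p = 0"
  shows "p = n \<or> p = - n"
proof -
  have p: "p = (n \<bullet> p) *\<^sub>R n"
    using unit_frame_expansion[OF assms(1), of p] assms(3) by (simp add: inner_perp_right)
  then have "norm p = \<bar>n \<bullet> p\<bar> * norm n" by (metis norm_scaleR)
  then have "\<bar>n \<bullet> p\<bar> = 1" using assms by simp
  then have "n \<bullet> p = 1 \<or> n \<bullet> p = -1" by linarith
  then show ?thesis using p by (metis scaleR_one scaleR_minus1_left)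
qed

text \<open>The circle is connected and has more than one point, so no point is isolated.
  Nontriviality of the filter is what identifies \<open>Lim\<close> with the limit.\<close>

lemma at_within_unit_sphere_nontrivial:
  assumes "norm (n :: real ^ 2) = 1"
  shows "at n within sphere 0 1 \<noteq> bot"
proof -
  have "connected (sphere (0 :: real ^ 2) 1)" by (rule connected_sphere) simp
  moreover have "- n \<noteq> n" using assms by (metis inner_minus_left norm_eq_1 one_neq_neg_one)
  moreover have sph: "n \<in> sphere 0 1" "- n \<in> sphere 0 1" using assms by auto
  moreover from sph have "\<nexists>x. sphere (0 :: real ^ 2) 1 = {x}" using \<open>- n \<noteq> n\<close> by (metis singletonD)
  ultimately have "n islimpt sphere 0 1" using connected_imp_perfect[of "sphere 0 1" n] by blast
  then show ?thesis by (simp add: trivial_limit_within)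
qed

text \<open>The closed half circle excludes \<open>- n\<close>, so the only singularity of the
  quotient is \<open>n\<close>, where \<open>stab_F\<close> is its limit.\<close>

lemma continuous_on_stab_F:
  assumes C2: "C2_on (UNIV - {0}) (hom_ext \<gamma>)" and n: "norm n = 1" and "\<gamma> n > 0"
  shows "continuous_on {p \<in> sphere 0 1. p \<bullet> n \<ge> 0} (stab_F \<gamma> n)"
  unfolding continuous_on_def
proof
  let ?A = "{p \<in> sphere 0 1. p \<bullet> n \<ge> 0}"
  fix q assume q: "q \<in> ?A"
  show "(stab_F \<gamma> n \<longlongrightarrow> stab_F \<gamma> n q) (at q within ?A)"
  proof (cases "q = n")
    case True
    obtain l where l: "(stab_quotient \<gamma> n \<longlongrightarrow> l) (at n within sphere 0 1)"
      using stab_quotient_convergent[OF assms] by blast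
    then have "stab_F \<gamma> n n = l"
      using tendsto_Lim[OF at_within_unit_sphere_nontrivial[OF n]] by (simp add: stab_F_def)
    moreover have "(stab_quotient \<gamma> n \<longlongrightarrow> l) (at n within ?A)"
      by (rule tendsto_within_subset[OF l]) auto
    moreover have "\<forall>\<^sub>F p in at n within ?A. stab_quotient \<gamma> n p = stab_F \<gamma> n p"
      by (auto simp: eventually_at_filter stab_F_def)
    ultimately show ?thesis
      unfolding True by (simp add: Lim_transform_eventually)
  next
    case False
    have q1: "norm q = 1" "q \<noteq> 0" using q by auto
    have "q \<noteq> - n" using q n by (auto simp: norm_eq_1)
    then have nz: "n \<bullet> perp q \<noteq> 0" using unit_vector_eq_or_opposite[OF n q1(1)] False by blast
    \<comment> \<open>\<open>\<gamma>\<close> itself is controlled only on the circle; its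
      continuity there is inherited from the extension.\<close>
    have "isCont (hom_ext \<gamma>) q"
      using C2_on_gradient(1)[OF C2] q1
      by (auto simp: open_delete gderiv_def intro: has_derivative_continuous)
    then have "(hom_ext \<gamma> \<longlongrightarrow> hom_ext \<gamma> q) (at q within ?A)"
      unfolding isCont_def by (rule tendsto_within_subset) simp
    moreover have "\<forall>\<^sub>F p in at q within ?A. hom_ext \<gamma> p = \<gamma> p"
      by (auto simp: eventually_at_filter hom_ext_unit)
    ultimately have g: "(\<gamma> \<longlongrightarrow> \<gamma> q) (at q within ?A)"
      unfolding hom_ext_unit[OF q1(1)] by (rule Lim_transform_eventually)
    have pe: "((\<lambda>p. x \<bullet> perp p) \<longlongrightarrow> x \<bullet> perp q) (at q within ?A)" for x
      unfolding inner_perp_right by (intro tendsto_intros)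
    have "(stab_quotient \<gamma> n \<longlongrightarrow> stab_quotient \<gamma> n q) (at q within ?A)"
      unfolding stab_quotient_def[abs_def] using nz \<open>\<gamma> n > 0\<close> by (intro tendsto_intros g pe) auto
    moreover have "\<forall>\<^sub>F p in at q within ?A. stab_quotient \<gamma> n p = stab_F \<gamma> n p"
    proof -
      have "\<forall>\<^sub>F p in at q within ?A. p \<noteq> n"
        using t1_space_nhds[OF False] by (auto simp: eventually_at_filter elim: eventually_mono)
      then show ?thesis by eventually_elim (simp add: stab_F_def)
    qed
    moreover have "stab_F \<gamma> n q = stab_quotient \<gamma> n q" using False by (simp add: stab_F_def)
    ultimately show ?thesis by (simp add: Lim_transform_eventually)
  qed
qed

text \<open>A continuous function on the compact half circle attains its supremum, so
  \<open>GREATEST\<close> in \<open>min_stab\<close> returns a true maximum.\<close>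

lemma stab_F_le_min_stab:
  assumes "C2_on (UNIV - {0}) (hom_ext \<gamma>)" and n: "norm n = 1" and "\<gamma> n > 0"
    and p: "norm p = 1" "p \<bullet> n \<ge> 0"
  shows "stab_F \<gamma> n p \<le> min_stab \<gamma> n"
proof -
  let ?A = "{p \<in> sphere 0 1. p \<bullet> n \<ge> 0}"
  have "?A = sphere 0 1 \<inter> {p. p \<bullet> n \<ge> 0}" by auto
  moreover have "closed {p. p \<bullet> n \<ge> 0}" by (intro closed_Collect_le continuous_intros)
  ultimately have "compact ?A" by (simp add: compact_Int_closed)
  moreover have "p \<in> ?A" using p by simp
  ultimately obtain q where q: "q \<in> ?A" "\<forall>r\<in>?A. stab_F \<gamma> n r \<le> stab_F \<gamma> n q"
    using continuous_attains_sup[OF _ _ continuous_on_stab_F[OF assms(1-3)]] by blast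
  have "min_stab \<gamma> n = stab_F \<gamma> n q"
    unfolding min_stab_def by (rule Greatest_equality) (use q in auto)
  then show ?thesis using q p by simp
qed

section \<open>The local energy estimate\<close>

text \<open>This is \<open>stab_F \<gamma> n p \<le> k n\<close> multiplied by its positive
  denominator. At \<open>p = n\<close> both sides equal \<open>(\<gamma> n)\<^sup>2\<close>, and the
  opposite half circle follows because both sides are even in \<open>p\<close>.\<close>

lemma surface_energy_matrix_lower_bound:
  assumes C2: "C2_on (UNIV - {0}) (hom_ext \<gamma>)"
    and pos: "\<forall>n\<in>sphere 0 1. \<gamma> n > 0" and sym: "\<forall>n\<in>sphere 0 1. \<gamma> (- n) = \<gamma> n"
    and n: "norm n = 1" and k: "k n \<ge> min_stab \<gamma> n" and p: "norm p = 1"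
  shows "(\<gamma> p)\<^sup>2 \<le> \<gamma> n * ((surface_energy_matrix \<gamma> k n *v perp p) \<bullet> perp p)"
proof -
  have gn: "\<gamma> n > 0" using pos n by simp
  have half: "(\<gamma> p)\<^sup>2 \<le> \<gamma> n * ((surface_energy_matrix \<gamma> k n *v perp p) \<bullet> perp p)"
    if p: "norm p = 1" "p \<bullet> n \<ge> 0" for p
  proof -
    define a where "a = n \<bullet> perp p"
    define x where "x = cahn_hoffman \<gamma> n \<bullet> perp p"
    have pp: "perp p \<bullet> perp p = 1" using p by (simp add: norm_eq_1[symmetric])
    have eq: "\<gamma> n * ((surface_energy_matrix \<gamma> k n *v perp p) \<bullet> perp p)
        = (\<gamma> n)\<^sup>2 - 2 * \<gamma> n * x * a + k n * (\<gamma> n * a\<^sup>2)"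
      unfolding surface_energy_matrix_quadratic pp a_def[symmetric] x_def[symmetric]
      by (simp add: power2_eq_square algebra_simps)
    show ?thesis
    proof (cases "p = n")
      case True
      then have "a = 0" by (simp add: a_def inner_vec2)
      then show ?thesis unfolding eq using True by simp
    next
      case False
      have "p \<noteq> - n" using p n by (auto simp: norm_eq_1)
      then have "a \<noteq> 0" using unit_vector_eq_or_opposite[OF n p(1)] False by (auto simp: a_def)
      then have d: "\<gamma> n * a\<^sup>2 > 0" using gn by simp
      have "stab_quotient \<gamma> n p \<le> k n"
        using stab_F_le_min_stab[OF C2 n gn p] k False by (simp add: stab_F_def)
      then have "(\<gamma> p)\<^sup>2 - (\<gamma> n)\<^sup>2 + 2 * \<gamma> n * x * a \<le> k n * (\<gamma> n * a\<^sup>2)"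
        unfolding stab_quotient_def a_def[symmetric] x_def[symmetric] using d
        by (simp add: pos_divide_le_eq)
      then show ?thesis unfolding eq by linarith
    qed
  qed
  show ?thesis
  proof (cases "p \<bullet> n \<ge> 0")
    case True
    then show ?thesis using half p by blast
  next
    case False
    then show ?thesis using half[of "- p"] p sym
      unfolding surface_energy_matrix_quadratic by (simp add: perp_minus)
  qed
qed

text \<open>Both sides scale with the square of \<open>norm v\<close>, so the unit case suffices;
  \<open>- perp v\<close> is the normal direction belonging to the tangent \<open>v\<close>.\<close>

lemma surface_energy_matrix_lower_bound_hom:
  assumes C2: "C2_on (UNIV - {0}) (hom_ext \<gamma>)"
    and pos: "\<forall>n\<in>sphere 0 1. \<gamma> n > 0" and sym: "\<forall>n\<in>sphere 0 1. \<gamma> (- n) = \<gamma> n"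
    and n: "norm n = 1" and k: "k n \<ge> min_stab \<gamma> n"
  shows "(hom_ext \<gamma> (- perp v))\<^sup>2 \<le> \<gamma> n * ((surface_energy_matrix \<gamma> k n *v v) \<bullet> v)"
proof (cases "v = 0")
  case True
  then have "perp v = 0" by simp
  with True show ?thesis by (simp add: hom_ext_def)
next
  case False
  \<comment> \<open>Two quarter turns give minus the identity, so \<open>perp p\<close> is the
    direction of \<open>v\<close>.\<close>
  define p where "p = - perp v /\<^sub>R norm v"
  have p: "norm p = 1" using False by (simp add: p_def)
  have v: "v = norm v *\<^sub>R perp p" "- perp v = norm v *\<^sub>R p"
    using False by (simp_all add: p_def perp_scaleR perp_minus)
  have "hom_ext \<gamma> (- perp v) = norm v * \<gamma> p"
    unfolding v(2) using False p by (simp add: hom_ext_scaleR hom_ext_unit)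
  moreover have "(surface_energy_matrix \<gamma> k n *v v) \<bullet> v
      = (norm v)\<^sup>2 * ((surface_energy_matrix \<gamma> k n *v perp p) \<bullet> perp p)"
    using v(1) by (metis (no_types, lifting) inner_scaleR_left inner_scaleR_right
        matrix_vector_mult_scaleR mult.assoc power2_eq_square)
  moreover have "(norm v)\<^sup>2 * (\<gamma> p)\<^sup>2
      \<le> (norm v)\<^sup>2 * (\<gamma> n * ((surface_energy_matrix \<gamma> k n *v perp p) \<bullet> perp p))"
    by (rule mult_left_mono[OF surface_energy_matrix_lower_bound[where k = k, OF assms p]]) simp
  ultimately show ?thesis by (simp add: power_mult_distrib algebra_simps)
qed

text \<open>In the application \<open>perp n\<close> is the old unit tangent and \<open>v\<close>
  the new edge per unit of old length, so the left side is the energy change per unit of old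
  length.\<close>

lemma local_energy_estimate:
  assumes C2: "C2_on (UNIV - {0}) (hom_ext \<gamma>)"
    and pos: "\<forall>n\<in>sphere 0 1. \<gamma> n > 0" and sym: "\<forall>n\<in>sphere 0 1. \<gamma> (- n) = \<gamma> n"
    and n: "norm n = 1" and k: "k n \<ge> min_stab \<gamma> n"
  shows "hom_ext \<gamma> (- perp v) - \<gamma> n \<le> (surface_energy_matrix \<gamma> k n *v v) \<bullet> (v - perp n)"
proof -
  define Z where "Z = surface_energy_matrix \<gamma> k n"
  define t where "t = perp n"
  define b where "b = hom_ext \<gamma> (- perp v)"
  have gn: "\<gamma> n > 0" using pos n by simp
  note lb = surface_energy_matrix_lower_bound_hom[where k = k, OF assms, folded Z_def]
  \<comment> \<open>The lower bound is bounded below by a square, hence \<open>Z\<close> is positive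
    semidefinite; it is evaluated at \<open>v - t\<close> and expanded.\<close>
  have "0 \<le> \<gamma> n * ((Z *v (v - t)) \<bullet> (v - t))" using lb[of "v - t"] by (meson order_trans zero_le_power2)
  then have "0 \<le> (Z *v (v - t)) \<bullet> (v - t)" using gn by (simp add: zero_le_mult_iff)
  also have "\<dots> = (Z *v v) \<bullet> v - 2 * ((Z *v v) \<bullet> t) + (Z *v t) \<bullet> t"
    using surface_energy_matrix_symmetric[of \<gamma> k n t v, folded Z_def]
    by (simp add: matrix_vector_mult_diff_distrib inner_diff_left inner_diff_right)
  finally have 1: "2 * ((Z *v v) \<bullet> t) \<le> (Z *v v) \<bullet> v + (Z *v t) \<bullet> t" by simp
  have tt: "t \<bullet> t = 1" "n \<bullet> t = 0" using n by (auto simp: t_def norm_eq_1 inner_vec2)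
  \<comment> \<open>Since \<open>n\<close> and \<open>t\<close> are orthogonal, only the multiple
    \<open>\<gamma> n\<close> of the identity contributes.\<close>
  have 2: "(Z *v t) \<bullet> t = \<gamma> n"
    unfolding Z_def surface_energy_matrix_quadratic tt by simp
  have "b\<^sup>2 / \<gamma> n \<le> (Z *v v) \<bullet> v"
    using lb[of v] gn by (simp add: b_def pos_divide_le_eq mult.commute)
  moreover have "2 * b - \<gamma> n \<le> b\<^sup>2 / \<gamma> n"
  proof -
    have "0 \<le> (b - \<gamma> n)\<^sup>2" by simp
    then have "(2 * b - \<gamma> n) * \<gamma> n \<le> b\<^sup>2" by (simp add: power2_eq_square algebra_simps)
    then show ?thesis using gn by (simp add: pos_le_divide_eq)
  qed
  ultimately have "2 * b - 2 * \<gamma> n \<le> 2 * ((Z *v v) \<bullet> (v - t))"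
    using 1 2 by (simp add: inner_diff_right)
  then show ?thesis by (simp add: b_def Z_def t_def)
qed


section \<open>Mass lumping on piecewise affine functions\<close>

text \<open>Interpolation of nodal values, \<open>real N\<close> being the inverse mesh size. The
  general codomain lets scalar and vector elements share the lemmas below.\<close>

definition piecewise_affine :: "nat \<Rightarrow> (real \<Rightarrow> 'a :: real_normed_vector) \<Rightarrow> bool" where
  "piecewise_affine N f \<longleftrightarrow> (\<forall>j\<in>{1..N}. \<forall>\<rho>\<in>{node N (j - 1)..node N j}.
     f \<rho> = f (node N (j - 1)) + ((\<rho> - node N (j - 1)) * real N) *\<^sub>R (f (node N j) - f (node N (j - 1))))"

lemma piecewise_affineD:
  assumes "piecewise_affine N f" "j \<in> {1..N}" "\<rho> \<in> {node N (j - 1)..node N j}"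
  shows "f \<rho> = f (node N (j - 1)) + ((\<rho> - node N (j - 1)) * real N) *\<^sub>R (f (node N j) - f (node N (j - 1)))"
  using assms unfolding piecewise_affine_def by blast

lemma node_diff: "j \<ge> 1 \<Longrightarrow> node N j - node N (j - 1) = 1 / real N"
  by (simp add: node_def of_nat_diff diff_divide_distrib)

lemma node_less: "N > 0 \<Longrightarrow> j \<ge> 1 \<Longrightarrow> node N (j - 1) < node N j"
  using node_diff[of j N] by (simp add: field_simps node_def)

lemma poly_degree_le_1:
  fixes p :: "real poly"
  assumes "degree p \<le> 1"
  shows "poly p x = coeff p 0 + x * coeff p 1"
proof -
  have "p = [:coeff p 0, coeff p 1:]"
    using assms by (intro poly_eqI) (auto simp: coeff_pCons coeff_eq_0 split: nat.split)
  then have "poly p x = poly [:coeff p 0, coeff p 1:] x" by simp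
  then show ?thesis by simp
qed

lemma Kh_piecewise_affine:
  assumes "N > 0" "u \<in> Kh N"
  shows "piecewise_affine N u"
  unfolding piecewise_affine_def
proof (intro ballI)
  fix j \<rho> assume j: "j \<in> {1..N}" and \<rho>: "\<rho> \<in> {node N (j - 1)..node N j}"
  define a b where "a = node N (j - 1)" and "b = node N j"
  obtain p :: "real poly" where p: "degree p \<le> 1" "\<forall>\<rho>\<in>{a..b}. u \<rho> = poly p \<rho>"
    using assms(2) j unfolding Kh_def a_def b_def by blast
  have u: "u x = coeff p 0 + x * coeff p 1" if "x \<in> {a..b}" for x
    using p that by (simp add: poly_degree_le_1)
  have ab: "real N * (b - a) = 1" "a < b"
    using node_diff[of j N] node_less[of N j] j assms(1) by (simp_all add: a_def b_def)
  have ua: "u a = coeff p 0 + a * coeff p 1" and ub: "u b = coeff p 0 + b * coeff p 1"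
    using u ab(2) by simp_all
  have r: "\<rho> \<in> {a..b}" using \<rho> by (simp add: a_def b_def)
  have "u a + (\<rho> - a) * real N * (u b - u a) = coeff p 0 + a * coeff p 1 + (\<rho> - a) * (real N * (b - a)) * coeff p 1"
    unfolding ua ub by (simp add: algebra_simps)
  also have "\<dots> = u \<rho>" unfolding ab(1) u[OF r] by (simp add: algebra_simps)
  finally show "u \<rho> = u (node N (j - 1)) + ((\<rho> - node N (j - 1)) * real N) *\<^sub>R (u (node N j) - u (node N (j - 1)))"
    by (simp add: a_def b_def)
qed

lemma Kh2_piecewise_affine:
  assumes "N > 0" "X \<in> Kh2 N"
  shows "piecewise_affine N X"
proof -
  have "piecewise_affine N (\<lambda>\<rho>. X \<rho> $ i)" for i
    using assms by (intro Kh_piecewise_affine) (auto simp: Kh2_def)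
  note component = piecewise_affineD[OF this]
  show ?thesis
    unfolding piecewise_affine_def vec_eq_iff
  proof (intro ballI allI)
    fix j \<rho> i assume "j \<in> {1..N}" "\<rho> \<in> {node N (j - 1)..node N j}"
    from component[OF this, of i]
    show "X \<rho> $ i = (X (node N (j - 1)) +
        ((\<rho> - node N (j - 1)) * real N) *\<^sub>R (X (node N j) - X (node N (j - 1)))) $ i"
      by simp
  qed
qed

lemma Kh_continuous: "u \<in> Kh N \<Longrightarrow> continuous_on UNIV u"
  by (simp add: Kh_def)

lemma Kh2_continuous:
  assumes "X \<in> Kh2 N"
  shows "continuous_on UNIV X"
proof -
  have "continuous_on UNIV (\<lambda>\<rho>. \<chi> i. X \<rho> $ i)"
    using assms by (intro continuous_on_vec_lambda) (auto simp: Kh2_def Kh_def)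
  then show ?thesis by simp
qed

text \<open>Nodes \<open>N\<close> and \<open>0\<close> are the parameters 1 and 0, identified by
  periodicity; this makes telescoping sums around the curve vanish.\<close>

lemma Kh2_closed:
  assumes "N > 0" "X \<in> Kh2 N"
  shows "X (node N N) = X (node N 0)"
proof -
  have "X (0 + 1) $ i = X 0 $ i" for i using assms(2) unfolding Kh2_def Kh_def by blast
  then show ?thesis using assms(1) by (simp add: vec_eq_iff node_def)
qed

lemma Kh_const: "(\<lambda>_. c) \<in> Kh N"
  unfolding Kh_def by (auto intro!: exI[of _ "[:c:]"])

lemma Kh_diff:
  assumes "u \<in> Kh N" "v \<in> Kh N"
  shows "(\<lambda>\<rho>. u \<rho> - v \<rho>) \<in> Kh N"
proof -
  have "\<exists>p :: real poly. degree p \<le> 1 \<and> (\<forall>\<rho>\<in>{node N (j - 1)..node N j}. u \<rho> - v \<rho> = poly p \<rho>)"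
    if j: "j \<in> {1..N}" for j
  proof -
    obtain p q :: "real poly" where
      "degree p \<le> 1" "\<forall>\<rho>\<in>{node N (j - 1)..node N j}. u \<rho> = poly p \<rho>"
      "degree q \<le> 1" "\<forall>\<rho>\<in>{node N (j - 1)..node N j}. v \<rho> = poly q \<rho>"
      using assms j unfolding Kh_def by blast
    then show ?thesis by (intro exI[of _ "p - q"]) (auto intro: degree_diff_le)
  qed
  moreover have "continuous_on UNIV (\<lambda>\<rho>. u \<rho> - v \<rho>)"
    using assms by (intro continuous_on_diff Kh_continuous)
  moreover have "u (\<rho> + 1) - v (\<rho> + 1) = u \<rho> - v \<rho>" for \<rho>
    using assms unfolding Kh_def by simp
  ultimately show ?thesis unfolding Kh_def mem_Collect_eq by blast
qed

lemma Kh2_diff: "X \<in> Kh2 N \<Longrightarrow> Y \<in> Kh2 N \<Longrightarrow> (\<lambda>\<rho>. X \<rho> - Y \<rho>) \<in> Kh2 N"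
  by (auto simp: Kh2_def intro: Kh_diff)

text \<open>Differentiation is confined to open cells because kinks may sit at the nodes.\<close>

lemma piecewise_affine_vector_derivative:
  assumes "piecewise_affine N f" "j \<in> {1..N}" "\<rho> \<in> {node N (j - 1)<..<node N j}"
  shows "vector_derivative f (at \<rho>) = real N *\<^sub>R (f (node N j) - f (node N (j - 1)))"
proof (rule vector_derivative_at)
  let ?I = "{node N (j - 1)<..<node N j}"
  let ?d = "f (node N j) - f (node N (j - 1))"
  have "((\<lambda>\<rho>. f (node N (j - 1)) + ((\<rho> - node N (j - 1)) * real N) *\<^sub>R ?d)
      has_vector_derivative real N *\<^sub>R ?d) (at \<rho>)"
    by (auto intro!: derivative_eq_intros)
  then show "(f has_vector_derivative real N *\<^sub>R ?d) (at \<rho>)"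
  proof (rule has_vector_derivative_transform_within_open[where S = ?I])
    show "f (node N (j - 1)) + ((y - node N (j - 1)) * real N) *\<^sub>R ?d = f y" if "y \<in> ?I" for y
      using piecewise_affineD[OF assms(1,2), of y] that by simp
  qed (use assms(3) in auto)
qed

lemma arc_deriv_piecewise_affine:
  assumes "N > 0" "piecewise_affine N X" "piecewise_affine N f"
    and "j \<in> {1..N}" "\<rho> \<in> {node N (j - 1)<..<node N j}"
  shows "arc_deriv X f \<rho> = (f (node N j) - f (node N (j - 1))) /\<^sub>R norm (edge N X j)"
  using assms by (simp add: arc_deriv_def piecewise_affine_vector_derivative[of N _ j] edge_def)

lemma normal_eq_edge_normal:
  assumes "N > 0" "j \<in> {1..N}" "\<rho> \<in> {node N (j - 1)<..<node N j}"
  shows "normal N X \<rho> = edge_normal N X j"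
proof -
  have "real j - 1 < \<rho> * real N" "\<rho> * real N < real j"
    using assms by (auto simp: node_def field_simps of_nat_diff)
  then have "\<lceil>\<rho> * real N\<rceil> = int j" by (intro ceiling_unique) auto
  then show ?thesis by (simp add: normal_def)
qed

text \<open>Inside cell \<open>j\<close> the integrand agrees with a globally continuous
  \<open>w j\<close>, so the one-sided limits are values of \<open>w j\<close>. The dependence on
  \<open>j\<close> accommodates jumps at the nodes.\<close>

lemma lumped_eq:
  assumes "N > 0"
    and eq: "\<And>j \<rho>. j \<in> {1..N} \<Longrightarrow> \<rho> \<in> {node N (j - 1)<..<node N j} \<Longrightarrow> u \<rho> \<bullet> v \<rho> = w j \<rho>"
    and cont: "\<And>j. continuous_on UNIV (w j)"
  shows "lumped N X u v =
    1 / 2 * (\<Sum>j = 1..N. norm (edge N X j) * (w j (node N j) + w j (node N (j - 1))))"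
proof -
  have L: "Lim (at_left (node N j)) (\<lambda>\<rho>. u \<rho> \<bullet> v \<rho>) = w j (node N j)"
    "Lim (at_right (node N (j - 1))) (\<lambda>\<rho>. u \<rho> \<bullet> v \<rho>) = w j (node N (j - 1))"
    if j: "j \<in> {1..N}" for j
  proof -
    have w: "(w j \<longlongrightarrow> w j x) (at x within A)" for x A
      using continuous_on_subset[OF cont subset_UNIV] cont
      by (meson UNIV_I continuous_on_def subset_UNIV tendsto_within_subset)
    have lt: "node N (j - 1) < node N j" using node_less[of N j] j assms(1) by simp
    have "\<forall>\<^sub>F \<rho> in at_left (node N j). w j \<rho> = u \<rho> \<bullet> v \<rho>"
      by (rule eventually_at_leftI[OF _ lt]) (simp add: eq[OF j])
    then have "((\<lambda>\<rho>. u \<rho> \<bullet> v \<rho>) \<longlongrightarrow> w j (node N j)) (at_left (node N j))"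
      by (rule Lim_transform_eventually[OF w])
    then show "Lim (at_left (node N j)) (\<lambda>\<rho>. u \<rho> \<bullet> v \<rho>) = w j (node N j)"
      by (intro tendsto_Lim) (simp_all add: trivial_limit_at_left_real)
    have "\<forall>\<^sub>F \<rho> in at_right (node N (j - 1)). w j \<rho> = u \<rho> \<bullet> v \<rho>"
      by (rule eventually_at_rightI[OF _ lt]) (simp add: eq[OF j])
    then have "((\<lambda>\<rho>. u \<rho> \<bullet> v \<rho>) \<longlongrightarrow> w j (node N (j - 1))) (at_right (node N (j - 1)))"
      by (rule Lim_transform_eventually[OF w])
    then show "Lim (at_right (node N (j - 1))) (\<lambda>\<rho>. u \<rho> \<bullet> v \<rho>) = w j (node N (j - 1))"
      by (intro tendsto_Lim) (simp_all add: trivial_limit_at_right_real)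
  qed
  show ?thesis unfolding lumped_def by (simp only: L cong: sum.cong)
qed

lemma lumped_piecewise_constant:
  assumes "N > 0"
    and "\<And>j \<rho>. j \<in> {1..N} \<Longrightarrow> \<rho> \<in> {node N (j - 1)<..<node N j} \<Longrightarrow> u \<rho> \<bullet> v \<rho> = c j"
  shows "lumped N X u v = (\<Sum>j = 1..N. norm (edge N X j) * c j)"
  using lumped_eq[of N u v "\<lambda>j _. c j" X] assms by (simp add: sum_distrib_left)

section \<open>One step of the scheme\<close>

locale SP_PFEM_step =
  fixes N :: nat and \<tau> :: real and \<gamma> k :: "real ^ 2 \<Rightarrow> real"
    and X Y :: "real \<Rightarrow> real ^ 2" and \<mu> :: "real \<Rightarrow> real"
  assumes N: "N > 0" and \<tau>: "\<tau> > 0"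
    and XY: "X \<in> Kh2 N" "Y \<in> Kh2 N" "\<mu> \<in> Kh N"
    and edge_nz: "j \<in> {1..N} \<Longrightarrow> edge N X j \<noteq> 0"
    and flow: "\<phi> \<in> Kh N \<Longrightarrow>
      lumped N X (\<lambda>\<rho>. ((Y \<rho> - X \<rho>) /\<^sub>R \<tau>) \<bullet> half_normal X Y \<rho>) \<phi>
        + lumped N X (arc_deriv X \<mu>) (arc_deriv X \<phi>) = 0"
    and curvature: "\<omega> \<in> Kh2 N \<Longrightarrow>
      lumped N X \<mu> (\<lambda>\<rho>. half_normal X Y \<rho> \<bullet> \<omega> \<rho>)
        - lumped N X (\<lambda>\<rho>. surface_energy_matrix \<gamma> k (normal N X \<rho>) *v arc_deriv X Y \<rho>)
            (arc_deriv X \<omega>) = 0"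
begin

definition edge_half_normal :: "nat \<Rightarrow> real ^ 2" where
  "edge_half_normal j = - ((1 / 2) *\<^sub>R perp ((edge N X j + edge N Y j) /\<^sub>R norm (edge N X j)))"

text \<open>The velocity term of the first equation without the factor \<open>1 / \<tau>\<close>. It
  also arises from the second equation, which is what couples the two.\<close>

definition velocity_form :: "(real \<Rightarrow> real) \<Rightarrow> real" where
  "velocity_form \<phi> = 1 / 2 * (\<Sum>j = 1..N. norm (edge N X j) *
     (((Y (node N j) - X (node N j)) \<bullet> edge_half_normal j) * \<phi> (node N j) +
      ((Y (node N (j - 1)) - X (node N (j - 1))) \<bullet> edge_half_normal j) * \<phi> (node N (j - 1))))"

lemma affine: "piecewise_affine N X" "piecewise_affine N Y" "piecewise_affine N \<mu>"
  using Kh2_piecewise_affine[OF N] Kh_piecewise_affine[OF N] XY by auto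

lemma half_normal_eq:
  assumes "j \<in> {1..N}" "\<rho> \<in> {node N (j - 1)<..<node N j}"
  shows "half_normal X Y \<rho> = edge_half_normal j"
  using arc_deriv_piecewise_affine[OF N affine(1) affine(1) assms]
    arc_deriv_piecewise_affine[OF N affine(1) affine(2) assms]
  by (simp add: half_normal_def edge_half_normal_def edge_def scaleR_add_right)

lemma lumped_velocity:
  assumes "\<phi> \<in> Kh N"
  shows "lumped N X (\<lambda>\<rho>. ((Y \<rho> - X \<rho>) /\<^sub>R \<tau>) \<bullet> half_normal X Y \<rho>) \<phi> = velocity_form \<phi> / \<tau>"
proof -
  have "lumped N X (\<lambda>\<rho>. ((Y \<rho> - X \<rho>) /\<^sub>R \<tau>) \<bullet> half_normal X Y \<rho>) \<phi> =
    1 / 2 * (\<Sum>j = 1..N. norm (edge N X j) *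
     (((Y (node N j) - X (node N j)) \<bullet> edge_half_normal j) * \<phi> (node N j) / \<tau> +
      ((Y (node N (j - 1)) - X (node N (j - 1))) \<bullet> edge_half_normal j) * \<phi> (node N (j - 1)) / \<tau>))"
    by (intro lumped_eq[OF N, where w = "\<lambda>j \<rho>. ((Y \<rho> - X \<rho>) \<bullet> edge_half_normal j) * \<phi> \<rho> / \<tau>"])
      (auto simp: half_normal_eq divide_inverse mult_ac
        intro!: continuous_intros Kh2_continuous[OF XY(1)] Kh2_continuous[OF XY(2)] Kh_continuous[OF assms])
  then show ?thesis
    by (simp add: velocity_form_def sum_divide_distrib add_divide_distrib distrib_left mult.commute[of \<tau>])
qed

text \<open>The displacement as test function turns the potential term of the second equation into
  the velocity term of the first one tested with \<open>\<mu>\<close>.\<close>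

lemma lumped_curvature:
  "lumped N X \<mu> (\<lambda>\<rho>. half_normal X Y \<rho> \<bullet> (Y \<rho> - X \<rho>)) = velocity_form \<mu>"
  unfolding velocity_form_def
  by (intro lumped_eq[OF N, where w = "\<lambda>j \<rho>. ((Y \<rho> - X \<rho>) \<bullet> edge_half_normal j) * \<mu> \<rho>"])
     (auto simp: half_normal_eq inner_commute
        intro!: continuous_intros Kh2_continuous[OF XY(1)] Kh2_continuous[OF XY(2)] Kh_continuous[OF XY(3)])

text \<open>
  The change of the area and the velocity form differ, edge by edge,
  only by the difference of a function of the two end points, so the sums agree on a closed curve.
\<close>

lemma area_conserved: "area N Y = area N X"
proof -
  \<comment> \<open>A constant test function has zero arclength derivative, so the diffusion term
    drops out.\<close>
  have "lumped N X (arc_deriv X \<mu>) (arc_deriv X (\<lambda>_. 1 :: real)) = 0"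
    using lumped_piecewise_constant[OF N, of "arc_deriv X \<mu>" "arc_deriv X (\<lambda>_. 1)" "\<lambda>_. 0" X] by (simp add: arc_deriv_def)
  then have zero: "velocity_form (\<lambda>_. 1) = 0"
    using flow[OF Kh_const[of 1]] lumped_velocity[OF Kh_const[of 1]] \<tau> by simp
  \<comment> \<open>The first two terms absorb the boundary part of the trapezoidal area formula;
    the last two are the cross product of the old and the new vertex.\<close>
  define T where "T j = X (node N j) $ 1 * X (node N j) $ 2 - Y (node N j) $ 1 * Y (node N j) $ 2
    + X (node N j) $ 1 * Y (node N j) $ 2 - Y (node N j) $ 1 * X (node N j) $ 2" for j
  define dA where "dA Z j = (Z (node N j) $ 1 - Z (node N (j - 1)) $ 1) *
    (Z (node N j) $ 2 + Z (node N (j - 1)) $ 2)" for Z :: "real \<Rightarrow> real ^ 2" and j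
  have "norm (edge N X j) * ((Y (node N j) - X (node N j)) \<bullet> edge_half_normal j +
      (Y (node N (j - 1)) - X (node N (j - 1))) \<bullet> edge_half_normal j)
      = dA Y j - dA X j + (T j - T (j - 1))" if "j \<in> {1..N}" for j
  proof -
    \<comment> \<open>The edge length cancels against the denominator in
      \<open>edge_half_normal\<close>. With the two displacements inserted this is, up to sign,
      twice the signed area of the quadrilateral swept by the edge.\<close>
    have pair: "norm (edge N X j) * (d \<bullet> edge_half_normal j + d' \<bullet> edge_half_normal j)
        = - (1 / 2) * ((d + d') \<bullet> perp (edge N X j + edge N Y j))" for d d'
      using edge_nz[OF that] unfolding edge_half_normal_def perp_scaleR
      by (simp add: inner_add_left) (simp add: field_simps)
    show ?thesis unfolding pair by (simp add: dA_def T_def inner_vec2 edge_def field_simps)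
  qed
  then have "velocity_form (\<lambda>_. 1) = 1 / 2 * (\<Sum>j = 1..N. dA Y j - dA X j + (T j - T (j - 1)))"
    by (simp add: velocity_form_def)
  also have "\<dots> = area N Y - area N X + 1 / 2 * (\<Sum>j = 1..N. T j - T (j - 1))"
    by (simp add: area_def dA_def sum.distrib sum_subtractf algebra_simps)
  also have "(\<Sum>j = 1..N. T j - T (j - 1)) = T N - T 0"
    using sum_telescope''[of 0 N T] by simp
  also have "T N = T 0"
    using Kh2_closed[OF N XY(1)] Kh2_closed[OF N XY(2)] by (simp add: T_def)
  finally have "velocity_form (\<lambda>_. 1) = area N Y - area N X" by simp
  with zero show ?thesis by simp
qed

lemma energy_dissipated:
  assumes C2: "C2_on (UNIV - {0}) (hom_ext \<gamma>)"
    and pos: "\<forall>n\<in>sphere 0 1. \<gamma> n > 0" and sym: "\<forall>n\<in>sphere 0 1. \<gamma> (- n) = \<gamma> n"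
    and k: "\<forall>n\<in>sphere 0 1. k n \<ge> min_stab \<gamma> n"
    and Y_nz: "\<And>j. j \<in> {1..N} \<Longrightarrow> edge N Y j \<noteq> 0"
  shows "energy N \<gamma> Y \<le> energy N \<gamma> X"
proof -
  define e where "e j = norm (edge N X j)" for j
  define v where "v j = edge N Y j /\<^sub>R e j" for j
  define t where "t j = edge N X j /\<^sub>R e j" for j
  define B where "B j = (surface_energy_matrix \<gamma> k (edge_normal N X j) *v v j) \<bullet> (v j - t j)" for j
  have epos: "e j > 0" if "j \<in> {1..N}" for j using edge_nz[OF that] by (simp add: e_def)
  \<comment> \<open>With \<open>\<mu>\<close> as test function the diffusion term is a sum of
    squares, which forces the velocity form to be nonpositive.\<close>
  have "lumped N X (arc_deriv X \<mu>) (arc_deriv X \<mu>) =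
      (\<Sum>j = 1..N. norm (edge N X j) * ((\<mu> (node N j) - \<mu> (node N (j - 1))) /\<^sub>R e j)\<^sup>2)"
    by (rule lumped_piecewise_constant[OF N])
       (simp add: arc_deriv_piecewise_affine[OF N affine(1,3)] e_def power2_eq_square)
  then have "lumped N X (arc_deriv X \<mu>) (arc_deriv X \<mu>) \<ge> 0" by (simp add: sum_nonneg)
  then have "velocity_form \<mu> / \<tau> \<le> 0" using flow[OF XY(3)] lumped_velocity[OF XY(3)] by linarith
  then have "velocity_form \<mu> \<le> 0" using \<tau> by (simp add: divide_le_0_iff)
  moreover have D: "(\<lambda>\<rho>. Y \<rho> - X \<rho>) \<in> Kh2 N" using XY by (simp add: Kh2_diff)
  have "lumped N X (\<lambda>\<rho>. surface_energy_matrix \<gamma> k (normal N X \<rho>) *v arc_deriv X Y \<rho>)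
      (arc_deriv X (\<lambda>\<rho>. Y \<rho> - X \<rho>)) = (\<Sum>j = 1..N. norm (edge N X j) * B j)"
  proof (rule lumped_piecewise_constant[OF N])
    fix j \<rho> assume j: "j \<in> {1..N}" "\<rho> \<in> {node N (j - 1)<..<node N j}"
    have "arc_deriv X (\<lambda>\<rho>. Y \<rho> - X \<rho>) \<rho> = v j - t j"
      using arc_deriv_piecewise_affine[OF N affine(1) Kh2_piecewise_affine[OF N D] j]
      by (simp add: v_def t_def e_def edge_def algebra_simps)
    moreover have "arc_deriv X Y \<rho> = v j"
      using arc_deriv_piecewise_affine[OF N affine(1,2) j] by (simp add: v_def e_def edge_def)
    ultimately show "(surface_energy_matrix \<gamma> k (normal N X \<rho>) *v arc_deriv X Y \<rho>)
        \<bullet> arc_deriv X (\<lambda>\<rho>. Y \<rho> - X \<rho>) \<rho> = B j"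
      by (simp add: B_def normal_eq_edge_normal[OF N j])
  qed
  ultimately have le: "(\<Sum>j = 1..N. e j * B j) \<le> 0"
    using curvature[OF D] lumped_curvature by (simp add: e_def)
  have "norm (edge N Y j) * \<gamma> (edge_normal N Y j) - e j * \<gamma> (edge_normal N X j) \<le> e j * B j"
    if j: "j \<in> {1..N}" for j
  proof -
    have n: "norm (edge_normal N X j) = 1" "norm (edge_normal N Y j) = 1"
      using edge_nz[OF j] Y_nz[OF j] by (simp_all add: edge_normal_def)
    \<comment> \<open>The normal is minus the rotated tangent, so rotating it again recovers the
      tangent required by the local estimate.\<close>
    have "perp (edge_normal N X j) = t j"
      by (simp add: edge_normal_def t_def e_def perp_minus perp_scaleR)
    then have "hom_ext \<gamma> (- perp (v j)) - \<gamma> (edge_normal N X j) \<le> B j"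
      using local_energy_estimate[OF C2 pos sym n(1), of k "v j"] k n by (simp add: B_def)
    \<comment> \<open>A positive multiple of the new unit normal, so homogeneity produces the energy
      of the new edge divided by \<open>e j\<close>.\<close>
    moreover have "- perp (v j) = (norm (edge N Y j) / e j) *\<^sub>R edge_normal N Y j"
      using Y_nz[OF j] by (simp add: v_def edge_normal_def perp_scaleR field_simps)
    then have "hom_ext \<gamma> (- perp (v j)) = norm (edge N Y j) / e j * \<gamma> (edge_normal N Y j)"
      using epos[OF j] Y_nz[OF j] n by (simp add: hom_ext_scaleR hom_ext_unit)
    ultimately have "e j * (norm (edge N Y j) / e j * \<gamma> (edge_normal N Y j) - \<gamma> (edge_normal N X j)) \<le> e j * B j"
      using epos[OF j] by (intro mult_left_mono) auto
    then show ?thesis using epos[OF j] by (simp add: right_diff_distrib)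
  qed
  then have "energy N \<gamma> Y - energy N \<gamma> X \<le> (\<Sum>j = 1..N. e j * B j)"
    unfolding energy_def sum_subtractf[symmetric] by (intro sum_mono) (simp add: e_def)
  with le show ?thesis by simp
qed

end

section \<open>From one step to all time levels\<close>

theorem theorem3p1:
  fixes N :: nat and \<tau> :: real
    and \<gamma> k :: "real ^ 2 \<Rightarrow> real"
    and X :: "nat \<Rightarrow> real \<Rightarrow> real ^ 2" and \<mu> :: "nat \<Rightarrow> real \<Rightarrow> real"
  assumes "N > 0" and "\<tau> > 0"
    and "\<forall>n\<in>sphere 0 1. \<gamma> n > 0"
    and "\<forall>n\<in>sphere 0 1. \<gamma> (- n) = \<gamma> n"
    and "C2_on (UNIV - {0}) (hom_ext \<gamma>)"
    and "\<forall>n\<in>sphere 0 1. k n > 0"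
    and "\<forall>n\<in>sphere 0 1. k n \<ge> min_stab \<gamma> n"
    and "\<forall>m. \<forall>j\<in>{1..N}. edge N (X m) j \<noteq> 0"
    and "SP_PFEM N \<tau> \<gamma> k X \<mu>"
  shows "(\<forall>m. area N (X m) = area N (X 0)) \<and>
    area N (X 0) = 1 / 2 * (\<Sum>j = 1..N.
      (X 0 (node N j) $ 1 - X 0 (node N (j - 1)) $ 1) * (X 0 (node N j) $ 2 + X 0 (node N (j - 1)) $ 2)) \<and>
    (\<forall>m. energy N \<gamma> (X (Suc m)) \<le> energy N \<gamma> (X m) \<and> energy N \<gamma> (X m) \<le> energy N \<gamma> (X 0)) \<and>
    energy N \<gamma> (X 0) = (\<Sum>j = 1..N. norm (edge N (X 0) j) * \<gamma> (edge_normal N (X 0) j))"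
proof -
  have X: "X m \<in> Kh2 N" for m
    using assms(9) unfolding SP_PFEM_def by (cases m) auto
  have step: "SP_PFEM_step N \<tau> \<gamma> k (X m) (X (Suc m)) (\<mu> (Suc m))" for m
    using assms(1,2,8,9) X unfolding SP_PFEM_def by unfold_locales blast+
  have A: "area N (X m) = area N (X 0)" for m
    by (induction m) (simp_all add: SP_PFEM_step.area_conserved[OF step])
  have E: "energy N \<gamma> (X (Suc m)) \<le> energy N \<gamma> (X m)" for m
    using SP_PFEM_step.energy_dissipated[OF step assms(5,3,4,7)] assms(8) by blast
  have "energy N \<gamma> (X m) \<le> energy N \<gamma> (X 0)" for m
    by (rule lift_Suc_antimono_le[of "\<lambda>m. energy N \<gamma> (X m)", OF E]) simp
  with A E show ?thesis by (simp add: area_def energy_def)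
qed

end
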